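(* Let $a,b\in\mathbb{R}$, $c>0$ with $b^2-24ac>0$, let $Q_0\in\mathcal{S}_0^{(3)}$, and let $Q:[0,\infty)\to\mathcal{S}_0^{(3)}$ be the solution of $$\frac{d}{dt}Q=[W,Q]-\frac{\partial F}{\partial Q}(Q),\qquad Q(0)=Q_0 .$$ Let $$B(t)=e^{Wt}=\begin{pmatrix}\cos t&\sin t&0\\-\sin t&\cos t&0\\0&0&1\end{pmatrix}$$ and $U(t):=B^t(t)Q(t)B(t)$, where $B^t(t)$ is the transpose of $B(t)$. Then: (1) $U$ is a solution of the gradient flow system $$\frac{d}{dt}U=-\frac{\partial F}{\partial Q}(U),$$ for which all $\omega$-limit points belong to the set of stationary points (i.e. the zeros of $\frac{\partial F}{\partial Q}$). (2) Consequently, for any initial data $Q_0\in\mathcal{S}_0^{(3)}$ there exist a sequence $(t_k)_{k\in\mathbb{N}}$ with $t_k\to\infty$, a number $s\in\left\{0,\frac{b+\sqrt{b^2-24ac}}{4c},\frac{b-\sqrt{b^2-24ac}}{4c}\right\}$ (depending on $Q_0$ and on the time sequence) and a unit vector $(n_1,n_2,n_3)\in\mathbb{S}^2$ such that, with $n(t)=(n_1\cos t+n_2\sin t,\,-n_1\sin t+n_2\cos t,\,n_3)$, $$\lim_{k\to\infty}\left|Q(t_k)-s\left(n(t_k)\otimes n(t_k)-\tfrac13 Id\right)\right|=0 .$$ (3) Moreover, if $\{n,m,p\}$ is an orthonormal family of eigenvectors of $Q_0$, then $\{B(t)n,B(t)m,B(t)p\}$ is an orthonormal family of eigenvectors of $Q(t)$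 for every $t\ge 0$.
   Context: $\mathcal{S}_0^{(3)}$ denotes the space of real symmetric traceless $3\times3$ matrices. $Id$ is the $3\times 3$ identity matrix, $|Q|^2=\mathrm{tr}(Q^2)$ (Frobenius norm), $[W,Q]=WQ-QW$, $n\otimes n$ is the matrix with entries $n_in_j$, and $\mathbb{S}^2$ is the unit sphere in $\mathbb{R}^3$. The matrix $W$ is $$W=\begin{pmatrix}0&1&0\\-1&0&0\\0&0&0\end{pmatrix}.$$ For $Q\in\mathcal{S}_0^{(3)}$, $F(Q)=\frac a2\mathrm{tr}(Q^2)-\frac b3\mathrm{tr}(Q^3)+\frac c4\left(\mathrm{tr}(Q^2)\right)^2$, and its gradient in $\mathcal{S}_0^{(3)}$ is $$\frac{\partial F}{\partial Q}(Q)=aQ-b\left(Q^2-\tfrac13|Q|^2Id\right)+cQ|Q|^2 .$$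
   Formalization: Part (2) is stated only for b ≠ 0, since for b = 0 it is false: with a = −1, c = 1 and Q_0 = diag(1/√2, −1/√2, 0), Q(t) = B(t)Q_0B^t(t) stays at a constant positive distance from every s(n(t)⊗n(t) − Id/3). *)

theory Defs
  imports "HOL-Analysis.Analysis"
begin

text \<open>
  Matrices are of type \<open>real^3^3\<close>, with product \<open>**\<close>; the product \<open>*\<close> of the type class instance is
  entrywise and is not used. The library norm on \<open>real^3^3\<close> is the Frobenius norm; on symmetric
  matrices it satisfies \<open>|Q|\<^sup>2 = tr(Q\<^sup>2)\<close>, see \<open>norm_sq_eq_trace\<close> below.
\<close>

definition sym_traceless :: "(real^3^3) set" where
  "sym_traceless = {Q. transpose Q = Q \<and> trace Q = 0}"

definition commutator :: "real^3^3 \<Rightarrow> real^3^3 \<Rightarrow> real^3^3" where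
  "commutator A Q = A ** Q - Q ** A"

definition tensor_sq :: "real^3 \<Rightarrow> real^3^3" where
  "tensor_sq n = (\<chi> i j. n $ i * n $ j)"

definition Wmat :: "real^3^3" where
  "Wmat = vector [vector [0, 1, 0], vector [-1, 0, 0], vector [0, 0, 0]]"

definition F :: "real \<Rightarrow> real \<Rightarrow> real \<Rightarrow> real^3^3 \<Rightarrow> real" where
  "F a b c Q = a / 2 * trace (Q ** Q) - b / 3 * trace (Q ** Q ** Q) + c / 4 * (trace (Q ** Q))\<^sup>2"

text \<open>
  \<open>gradF\<close> is the gradient of \<open>F\<close> in the subspace \<^const>\<open>sym_traceless\<close>, see \<open>gradF_is_gradient\<close>.
\<close>

definition gradF :: "real \<Rightarrow> real \<Rightarrow> real \<Rightarrow> real^3^3 \<Rightarrow> real^3^3" where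
  "gradF a b c Q = a *\<^sub>R Q - b *\<^sub>R (Q ** Q - ((norm Q)\<^sup>2 / 3) *\<^sub>R mat 1) + (c * (norm Q)\<^sup>2) *\<^sub>R Q"

text \<open>Solutions on \<open>[0,\<infinity>)\<close>; the derivative at \<open>0\<close> is one-sided.\<close>

definition ode_solution :: "(real^3^3 \<Rightarrow> real^3^3) \<Rightarrow> (real \<Rightarrow> real^3^3) \<Rightarrow> bool" where
  "ode_solution f Q \<longleftrightarrow>
     (\<forall>t\<ge>0. Q t \<in> sym_traceless \<and> (Q has_vector_derivative f (Q t)) (at t within {0..}))"

definition omega_limit_set :: "(real \<Rightarrow> real^3^3) \<Rightarrow> (real^3^3) set" where
  "omega_limit_set V =
     {L. \<exists>t :: nat \<Rightarrow> real. filterlim t at_top sequentially \<and> (\<lambda>k. V (t k)) \<longlonglongrightarrow> L}"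

definition stationary_points :: "real \<Rightarrow> real \<Rightarrow> real \<Rightarrow> (real^3^3) set" where
  "stationary_points a b c = {Q \<in> sym_traceless. gradF a b c Q = 0}"

text \<open>
  The library's \<^const>\<open>exp\<close> is not available for \<open>real^3^3\<close>, since that type is not a Banach algebra
  under the matrix product.
\<close>

definition mat_pow :: "real^3^3 \<Rightarrow> nat \<Rightarrow> real^3^3" where
  "mat_pow A k = (((**) A) ^^ k) (mat 1)"

definition mat_exp :: "real^3^3 \<Rightarrow> real^3^3" where
  "mat_exp A = (\<Sum>k. (1 / fact k) *\<^sub>R mat_pow A k)"

definition Bmat :: "real \<Rightarrow> real^3^3" where
  "Bmat t = mat_exp (t *\<^sub>R Wmat)"

definition orthonormal_eigenvectors :: "real^3^3 \<Rightarrow> real^3 \<Rightarrow> real^3 \<Rightarrow> real^3 \<Rightarrow> bool" where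
  "orthonormal_eigenvectors A n m p \<longleftrightarrow>
     norm n = 1 \<and> norm m = 1 \<and> norm p = 1 \<and> n \<bullet> m = 0 \<and> n \<bullet> p = 0 \<and> m \<bullet> p = 0 \<and>
     (\<forall>v \<in> {n, m, p}. \<exists>l. A *v v = l *\<^sub>R v)"

lemma inner_eq_trace:
  assumes "transpose A = (A :: real^3^3)"
  shows "A \<bullet> H = trace (A ** H)"
proof -
  have "A \<bullet> H = (\<Sum>i\<in>UNIV. \<Sum>j\<in>UNIV. A $ i $ j * H $ i $ j)"
    by (simp add: inner_vec_def)
  also have "\<dots> = (\<Sum>i\<in>UNIV. \<Sum>j\<in>UNIV. transpose A $ i $ j * H $ i $ j)"
    by (simp only: assms)
  also have "\<dots> = (\<Sum>j\<in>UNIV. \<Sum>i\<in>UNIV. A $ j $ i * H $ i $ j)"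
    unfolding transpose_def vec_lambda_beta by (rule sum.swap)
  also have "\<dots> = trace (A ** H)"
    by (simp add: trace_def matrix_matrix_mult_def)
  finally show ?thesis .
qed

lemma norm_sq_eq_trace:
  "transpose Q = (Q :: real^3^3) \<Longrightarrow> (norm Q)\<^sup>2 = trace (Q ** Q)"
  by (simp add: power2_norm_eq_inner inner_eq_trace)

lemma matrix_mult_has_derivative:
  fixes f g :: "real^3^3 \<Rightarrow> real^3^3"
  assumes "(f has_derivative f') (at x within S)" "(g has_derivative g') (at x within S)"
  shows "((\<lambda>y. f y ** g y) has_derivative (\<lambda>h. f x ** g' h + f' h ** g x)) (at x within S)"
proof -
  have "bounded_bilinear ((**) :: real^3^3 \<Rightarrow> real^3^3 \<Rightarrow> real^3^3)"
    unfolding bilinear_conv_bounded_bilinear[symmetric] bilinear_def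
    by (auto intro!: linearI simp: matrix_matrix_mult_def vec_eq_iff sum.distrib
        sum_distrib_left algebra_simps)
  from bounded_bilinear.FDERIV[OF this assms] show ?thesis .
qed

lemma trace_has_derivative:
  fixes f :: "real^3^3 \<Rightarrow> real^3^3"
  assumes "(f has_derivative f') (at x within S)"
  shows "((\<lambda>y. trace (f y)) has_derivative (\<lambda>h. trace (f' h))) (at x within S)"
proof -
  have "bounded_linear (trace :: real^3^3 \<Rightarrow> real)"
    unfolding linear_conv_bounded_linear[symmetric]
    by (auto intro!: linearI simp: trace_def sum.distrib sum_distrib_left)
  from bounded_linear.has_derivative[OF this assms] show ?thesis .
qed

lemma gradF_is_gradient:
  assumes Q: "Q \<in> sym_traceless"
  shows "gradF a b c Q \<in> sym_traceless"
    and "(F a b c has_derivative (\<lambda>H. gradF a b c Q \<bullet> H)) (at Q within sym_traceless)"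
proof -
  have sym: "transpose Q = Q" and tr: "trace Q = 0"
    using Q by (auto simp: sym_traceless_def)
  have symQQ: "transpose (Q ** Q) = Q ** Q"
    by (simp add: matrix_transpose_mul sym)
  have trans_lin: "transpose (A - B) = transpose A - transpose B"
      "transpose (A + B) = transpose A + transpose B"
      "transpose (r *\<^sub>R A) = r *\<^sub>R transpose A" for A B :: "real^3^3" and r
    by (simp_all add: transpose_def vec_eq_iff)
  have trace_scale: "trace (r *\<^sub>R A) = r * trace A" for A :: "real^3^3" and r
    by (simp add: trace_def sum_distrib_left)
  have "transpose (gradF a b c Q) = gradF a b c Q"
    by (simp add: gradF_def trans_lin symQQ sym)
  moreover have "trace (gradF a b c Q) = 0"
    by (simp add: gradF_def trace_sub trace_add trace_scale trace_I tr norm_sq_eq_trace[OF sym])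
  ultimately show "gradF a b c Q \<in> sym_traceless"
    by (simp add: sym_traceless_def)
  define G where "G y = F a b c y + b / 3 * (norm Q)\<^sup>2 * trace y" for y
  have tr_eqs: "trace (H ** Q) = trace (Q ** H)" "trace (H ** Q ** Q) = trace (Q ** Q ** H)"
      "trace (Q ** H ** Q) = trace (Q ** Q ** H)" for H
    using trace_mul_sym[of H Q] trace_mul_sym[of H "Q ** Q"] trace_mul_sym[of "Q ** H" Q]
    by (simp_all add: matrix_mul_assoc)
  have add_mult: "(A + B) ** C = A ** C + B ** C" for A B C :: "real^3^3"
    by (simp add: matrix_matrix_mult_def vec_eq_iff sum.distrib distrib_right)
  have inner: "gradF a b c Q \<bullet> H =
      a * trace (Q ** H) - b * (trace (Q ** Q ** H) - (norm Q)\<^sup>2 / 3 * trace H)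
        + c * (norm Q)\<^sup>2 * trace (Q ** H)" for H
    by (simp add: gradF_def inner_add_left inner_diff_left inner_eq_trace[OF sym]
        inner_eq_trace[OF symQQ] inner_eq_trace[of "mat 1"])
  note id = has_derivative_ident[of "at Q within sym_traceless"]
  note sq = matrix_mult_has_derivative[OF id id]
  note d1 = trace_has_derivative[OF id] trace_has_derivative[OF sq]
    trace_has_derivative[OF matrix_mult_has_derivative[OF sq id]]
  have *: "(G has_derivative (\<lambda>H. gradF a b c Q \<bullet> H)) (at Q within sym_traceless)"
    unfolding G_def F_def inner
    apply (rule has_derivative_eq_rhs)
     apply (rule d1 derivative_eq_intros refl)+
    apply (rule ext)
    subgoal for H
      by (simp add: add_mult trace_add tr_eqs[of H] norm_sq_eq_trace[OF sym] field_simps)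
    done
  show "(F a b c has_derivative (\<lambda>H. gradF a b c Q \<bullet> H)) (at Q within sym_traceless)"
    by (rule has_derivative_transform[OF Q _ *]) (simp add: G_def sym_traceless_def)
qed

lemma Bmat_sums:
  "(\<lambda>k. (1 / fact k) *\<^sub>R mat_pow (t *\<^sub>R Wmat) k) sums
     vector [vector [cos t, sin t, 0], vector [- sin t, cos t, 0], vector [0, 0, 1]]"
proof -
  have pow: "(1 / fact k) *\<^sub>R mat_pow (t *\<^sub>R Wmat) k =
      vector [vector [cos_coeff k * t ^ k, sin_coeff k * t ^ k, 0],
              vector [- (sin_coeff k * t ^ k), cos_coeff k * t ^ k, 0],
              vector [0, 0, if k = 0 then 1 else 0]]" for k
  proof (induction k)
    case 0
    show ?case
      by (simp add: mat_pow_def mat_def vec_eq_iff forall_3)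
  next
    case (Suc k)
    have step: "(1 / fact (Suc k)) *\<^sub>R mat_pow (t *\<^sub>R Wmat) (Suc k) =
        (t / Suc k) *\<^sub>R (Wmat ** ((1 / fact k) *\<^sub>R mat_pow (t *\<^sub>R Wmat) k))"
      by (simp add: mat_pow_def vec_eq_iff matrix_matrix_mult_def sum_3 field_simps)
    show ?case
      unfolding step Suc
      by (simp add: Wmat_def vec_eq_iff forall_3 matrix_matrix_mult_def sum_3
          sin_coeff_Suc cos_coeff_Suc del: of_nat_Suc)
  qed
  have "(\<lambda>k. cos_coeff k * t ^ k) sums cos t" "(\<lambda>k. sin_coeff k * t ^ k) sums sin t"
    using cos_converges[of t] sin_converges[of t] by simp_all
  moreover have "(\<lambda>k. if k = 0 then 1 else 0 :: real) sums 1"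
    using sums_single[of 0 "\<lambda>_. 1::real"] by simp
  ultimately have "\<forall>i j. (\<lambda>k. ((1 / fact k) *\<^sub>R mat_pow (t *\<^sub>R Wmat) k) $ i $ j) sums
      (vector [vector [cos t, sin t, 0], vector [- sin t, cos t, 0], vector [0, 0, 1]]
        :: real^3^3) $ i $ j"
    unfolding pow by (simp add: forall_3 sums_minus)
  then show ?thesis
    unfolding sums_def by (auto intro!: vec_tendstoI)
qed

lemma Bmat_eq:
  "Bmat t = vector [vector [cos t, sin t, 0], vector [- sin t, cos t, 0], vector [0, 0, 1]]"
  unfolding Bmat_def mat_exp_def using Bmat_sums by (rule sums_unique[symmetric])

end

theory Submission
  imports Defs
begin

text \<open>
  The matrix \<open>B(t)\<close> is the rotation generated by \<open>W\<close>, and \<open>F\<close> is invariant under rotations. Passing to the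
  rotating frame \<open>U = B\<^sup>T Q B\<close> therefore removes the commutator from the equation and leaves the
  gradient flow of \<open>F\<close> (\<open>corotating_frame\<close>); everything else is a statement on this flow.

  Along the gradient flow \<open>F\<close> decreases at the rate \<open>|\<partial>F/\<partial>Q|\<^sup>2\<close>. Because \<open>c > 0\<close>, \<open>F\<close> is coercive on the symmetric
  traceless matrices, so trajectories are bounded and move with bounded speed. A trajectory that keeps
  returning to a non-stationary point would lose a fixed amount of energy at every visit, which is
  impossible as the energy at that point bounds the energy along the trajectory from below
  (\<open>omega_limit_stationary\<close>).

  If \<open>b \<noteq> 0\<close>, a stationary point is annihilated by a quadratic polynomial, so it has at most two
  eigenvalues. In dimension three a traceless symmetric matrix of this kind has the form
  \<open>s (n \<otimes> n - I / 3)\<close> (\<open>stationary_point_uniaxial\<close>), and the stationarity condition becomes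
  \<open>s (2 c s\<^sup>2 - b s + 3 a) = 0\<close> (\<open>gradF_uniaxial\<close>). By compactness \<open>U\<close> converges to such a point along a
  sequence of times; rotating back, the director \<open>n\<close> becomes \<open>B(t) n\<close>.

  A unit vector \<open>v\<close> is an eigenvector of the symmetric matrix \<open>U\<close> if and only if \<open>U\<close> commutes with \<open>v \<otimes> v\<close>.
  Commuting with a fixed matrix is preserved by the flow, since the commutator satisfies a linear
  differential equation (\<open>flow_preserves_commutation\<close>). Hence the eigenvectors of \<open>Q\<^sub>0\<close> remain eigenvectors
  of \<open>U\<close>, and \<open>B(t)\<close> carries them to eigenvectors of \<open>Q(t)\<close>.
\<close>


section \<open>Matrix algebra\<close>

lemma bounded_bilinear_matrix_mult:
  "bounded_bilinear ((**) :: real^'n^'m \<Rightarrow> real^'p^'n \<Rightarrow> real^'p^'m)"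
  unfolding bilinear_conv_bounded_bilinear[symmetric] bilinear_def
  by (auto intro!: linearI simp: matrix_matrix_mult_def vec_eq_iff sum.distrib
      sum_distrib_left algebra_simps)

interpretation matrix_mult: bounded_bilinear "(**) :: real^'n^'m \<Rightarrow> real^'p^'n \<Rightarrow> real^'p^'m"
  by (rule bounded_bilinear_matrix_mult)

lemma bounded_linear_transpose:
  "bounded_linear (transpose :: real^'n^'m \<Rightarrow> real^'m^'n)"
  unfolding linear_conv_bounded_linear[symmetric]
  by (auto intro!: linearI simp: transpose_def vec_eq_iff)

lemma transpose_linear_simps:
  fixes A B :: "real^'n^'m"
  shows "transpose (A + B) = transpose A + transpose B"
    "transpose (A - B) = transpose A - transpose B"
    "transpose (r *\<^sub>R A) = r *\<^sub>R transpose A"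
  by (simp_all add: transpose_def vec_eq_iff)

lemma trace_scaleR: "trace (r *\<^sub>R A) = r * trace (A :: real^'n^'n)"
  by (simp add: trace_def sum_distrib_left)

lemma symmetric_dot:
  assumes "transpose A = (A :: real^'n^'n)"
  shows "(A *v x) \<bullet> y = x \<bullet> (A *v y)"
  by (metis assms dot_lmul_matrix transpose_matrix_vector)

lemma tensor_sq_mult: "tensor_sq n *v v = (n \<bullet> v) *\<^sub>R n"
  by (simp add: tensor_sq_def matrix_vector_mult_def vec_eq_iff inner_vec_def sum_3 algebra_simps)

lemma transpose_tensor_sq: "transpose (tensor_sq n) = tensor_sq n"
  by (simp add: transpose_def tensor_sq_def vec_eq_iff)

lemma trace_tensor_sq: "norm n = 1 \<Longrightarrow> trace (tensor_sq n) = 1"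
  by (simp add: trace_def tensor_sq_def norm_eq_1 inner_vec_def)

lemma tensor_sq_idem: "norm n = 1 \<Longrightarrow> tensor_sq n ** tensor_sq n = tensor_sq n"
  by (simp add: matrix_eq tensor_sq_mult matrix_vector_mult_scaleR norm_eq_1
      flip: matrix_vector_mul_assoc)

lemma tensor_sq_image: "tensor_sq (R *v n) = R ** tensor_sq n ** transpose R"
proof -
  have "n \<bullet> (transpose R *v x) = (R *v n) \<bullet> x" for x
    by (metis dot_lmul_matrix inner_commute transpose_matrix_vector)
  then show ?thesis
    by (simp add: matrix_eq tensor_sq_mult matrix_vector_mult_scaleR del: transpose_matrix_vector
        flip: matrix_vector_mul_assoc)
qed

lemma orthogonal_conj_trace:
  assumes "orthogonal_matrix R"
  shows "trace (transpose R ** A ** R) = trace (A :: real^'n^'n)"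
  using assms by (metis matrix_mul_assoc matrix_mul_lid orthogonal_matrix_def trace_mul_sym)

lemma orthogonal_conj_mult:
  assumes "orthogonal_matrix R"
  shows "(transpose R ** A ** R) ** (transpose R ** B ** R) = transpose R ** (A ** B) ** (R :: real^'n^'n)"
  using assms by (metis matrix_mul_assoc matrix_mul_lid orthogonal_matrix_def)

lemma orthogonal_matrix_inner:
  assumes "orthogonal_matrix (R :: real^'n^'n)"
  shows "(R *v x) \<bullet> (R *v y) = x \<bullet> y"
  using dot_lmul_matrix[of x "transpose R" "R *v y"] assms
  by (simp add: matrix_vector_mul_assoc orthogonal_matrix del: transpose_matrix_vector)

lemma orthogonal_conj_sym_traceless:
  assumes "orthogonal_matrix R" "Q \<in> sym_traceless"
  shows "transpose R ** Q ** R \<in> sym_traceless"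
  using assms by (auto simp: sym_traceless_def orthogonal_conj_trace matrix_transpose_mul matrix_mul_assoc)

lemma orthogonal_conj_norm:
  assumes "orthogonal_matrix R" "transpose Q = (Q :: real^3^3)"
  shows "norm (transpose R ** Q ** R) = norm Q"
proof -
  have "transpose (transpose R ** Q ** R) = transpose R ** Q ** R"
    using assms by (simp add: matrix_transpose_mul matrix_mul_assoc)
  then have "(norm (transpose R ** Q ** R))\<^sup>2 = (norm Q)\<^sup>2"
    using assms by (simp add: norm_sq_eq_trace orthogonal_conj_mult orthogonal_conj_trace)
  then show ?thesis by simp
qed

text \<open>
  Every term of the gradient is built from products, the identity and the Frobenius norm, all of
  which are respected by conjugation with an orthogonal matrix. This isotropy is what makes the
  rotation disappear in the co-rotating frame.
\<close>

lemma gradF_orthogonal_conj: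
  assumes "orthogonal_matrix R" "transpose Q = Q"
  shows "gradF a b c (transpose R ** Q ** R) = transpose R ** gradF a b c Q ** R"
proof -
  have "transpose R ** mat 1 ** R = mat 1"
    using assms(1) by (simp add: orthogonal_matrix)
  then show ?thesis
    using assms
    by (simp add: gradF_def orthogonal_conj_norm orthogonal_conj_mult
        matrix_mult.add_left matrix_mult.add_right matrix_mult.diff_left matrix_mult.diff_right
        matrix_mult.scaleR_left matrix_mult.scaleR_right)
qed

section \<open>The co-rotating frame\<close>

lemma orthogonal_matrix_Bmat: "orthogonal_matrix (Bmat t)"
  by (simp add: orthogonal_matrix Bmat_eq vec_eq_iff forall_3 matrix_matrix_mult_def sum_3
      transpose_def mat_def power2_eq_square[symmetric])

lemma Bmat_mult_transpose: "Bmat t ** transpose (Bmat t) = mat 1"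
  "transpose (Bmat t) ** Bmat t = mat 1"
  using orthogonal_matrix_Bmat[of t] by (auto simp: orthogonal_matrix_def)

lemma Bmat_has_vector_derivative:
  "(Bmat has_vector_derivative Wmat ** Bmat t) (at t within S)"
proof -
  define P Z :: "real^3^3"
    where "P = vector [vector [1, 0, 0], vector [0, 1, 0], vector [0, 0, 0]]"
      and "Z = vector [vector [0, 0, 0], vector [0, 0, 0], vector [0, 0, 1]]"
  have B: "Bmat = (\<lambda>t. cos t *\<^sub>R P + sin t *\<^sub>R Wmat + Z)"
    by (rule ext) (simp add: Bmat_eq P_def Z_def Wmat_def vec_eq_iff forall_3)
  have "Wmat ** Bmat t = - sin t *\<^sub>R P + cos t *\<^sub>R Wmat"
    by (simp add: Bmat_eq P_def Wmat_def vec_eq_iff forall_3 matrix_matrix_mult_def sum_3)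
  then show ?thesis
    unfolding B by (auto intro!: derivative_eq_intros)
qed

text \<open>
  Since \<open>B' = W B\<close> and \<open>W\<close> is antisymmetric, differentiating \<open>B\<^sup>T Q B\<close> produces \<open>- B\<^sup>T [W, Q] B\<close> from the
  two outer factors; this cancels the commutator in the equation for \<open>Q\<close>, and isotropy turns what
  is left into the gradient at \<open>U\<close>.
\<close>

lemma corotating_frame:
  assumes Q: "ode_solution (\<lambda>M. commutator Wmat M - gradF a b c M) Q"
    and U: "\<And>t. 0 \<le> t \<Longrightarrow> U t = transpose (Bmat t) ** Q t ** Bmat t"
  shows "ode_solution (\<lambda>M. - gradF a b c M) U"
  unfolding ode_solution_def
proof (intro allI impI conjI)
  fix t :: real assume t: "0 \<le> t"
  have Qt: "Q t \<in> sym_traceless"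
    and Q': "(Q has_vector_derivative commutator Wmat (Q t) - gradF a b c (Q t)) (at t within {0..})"
    using Q t by (auto simp: ode_solution_def)
  show "U t \<in> sym_traceless"
    using U[OF t] orthogonal_conj_sym_traceless[OF orthogonal_matrix_Bmat Qt] by simp
  have W: "transpose Wmat = - Wmat"
    by (simp add: transpose_def Wmat_def vec_eq_iff forall_3)
  note B' = Bmat_has_vector_derivative[of t "{0..}"]
  have BT': "((\<lambda>t. transpose (Bmat t)) has_vector_derivative - (transpose (Bmat t) ** Wmat)) (at t within {0..})"
    using bounded_linear.has_vector_derivative[OF bounded_linear_transpose B']
    by (simp add: matrix_transpose_mul W matrix_mult.minus_right)
  have "((\<lambda>t. transpose (Bmat t) ** Q t ** Bmat t) has_vector_derivative
      - (transpose (Bmat t) ** gradF a b c (Q t) ** Bmat t)) (at t within {0..})"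
    by (rule has_vector_derivative_eq_rhs,
        rule matrix_mult.has_vector_derivative[OF matrix_mult.has_vector_derivative[OF BT' Q'] B'])
      (simp add: commutator_def matrix_mult.add_left matrix_mult.add_right matrix_mult.diff_left
        matrix_mult.diff_right matrix_mult.minus_left matrix_mult.minus_right matrix_mul_assoc)
  then show "(U has_vector_derivative - gradF a b c (U t)) (at t within {0..})"
    using U t Qt
    by (auto intro!: has_vector_derivative_transform[where f = "\<lambda>t. transpose (Bmat t) ** Q t ** Bmat t"]
        simp: gradF_orthogonal_conj[OF orthogonal_matrix_Bmat] sym_traceless_def)
qed

section \<open>Stationary points are uniaxial\<close>

text \<open>
  The vectors \<open>n\<close>, \<open>p\<close>, \<open>n \<times> p\<close> form an orthonormal basis. Lagrange's identity proves what is needed of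
  this: \<open>v \<times> (n \<times> p) = (v \<bullet> p) n - (v \<bullet> n) p\<close> vanishes, so \<open>v\<close> is both parallel and orthogonal to the unit
  vector \<open>n \<times> p\<close>.
\<close>

lemma zero_if_orthogonal_to_cross_frame:
  fixes n p v :: "real^3"
  assumes "norm n = 1" "norm p = 1" "n \<bullet> p = 0" "v \<bullet> n = 0" "v \<bullet> p = 0" "v \<bullet> cross3 n p = 0"
  shows "v = 0"
proof -
  have "(norm (cross3 n p))\<^sup>2 = 1"
    using norm_cross_dot[of n p] assms by simp
  moreover have "cross3 v (cross3 n p) = 0"
    using Lagrange[of v n p] assms by simp
  ultimately have "(norm v)\<^sup>2 = 0"
    using norm_cross_dot[of v "cross3 n p"] assms by (simp add: power_mult_distrib)
  then show ?thesis by simp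
qed

text \<open>
  Any nonzero vector in the range of \<open>A - \<beta> I\<close> is annihilated by \<open>A - \<alpha> I\<close>.
\<close>

lemma eigenvector_from_factor:
  fixes A :: "real^'n^'n"
  assumes "(A - \<alpha> *\<^sub>R mat 1) ** (A - \<beta> *\<^sub>R mat 1) = 0" and "A \<noteq> \<beta> *\<^sub>R mat 1"
  obtains n where "norm n = 1" "A *v n = \<alpha> *\<^sub>R n"
proof -
  obtain x where x: "(A - \<beta> *\<^sub>R mat 1) *v x \<noteq> 0"
    using assms(2) by (metis matrix_eq matrix_vector_mult_0 eq_iff_diff_eq_0)
  define y where "y = (A - \<beta> *\<^sub>R mat 1) *v x"
  have "(A - \<alpha> *\<^sub>R mat 1) *v y = 0"
    by (simp add: y_def matrix_vector_mul_assoc assms(1))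
  then have "A *v y = \<alpha> *\<^sub>R y"
    by (simp add: matrix_vector_mult_diff_rdistrib flip: scaleR_matrix_vector_assoc)
  then have "A *v ((1 / norm y) *\<^sub>R y) = \<alpha> *\<^sub>R ((1 / norm y) *\<^sub>R y)"
    by (simp add: matrix_vector_mult_scaleR)
  moreover have "norm ((1 / norm y) *\<^sub>R y) = 1"
    using x by (simp add: y_def)
  ultimately show ?thesis using that by blast
qed

text \<open>
  In dimension three two eigenvalues force one of them to be simple. Here the full spectral theorem
  can be avoided: the two linear factors provide unit eigenvectors \<open>n\<close> and \<open>p\<close> for \<open>\<alpha>\<close> and \<open>\<beta>\<close>, which
  are orthogonal by symmetry, and the third axis \<open>m = n \<times> p\<close> is then preserved by \<open>A\<close>. Its eigenvalue
  is \<open>\<alpha>\<close> or \<open>\<beta>\<close>, and the axis carrying the other one is the axis of the rank-one part.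
\<close>

lemma two_eigenvalues_rank_one_perturbation:
  fixes A :: "real^3^3"
  assumes sym: "transpose A = A" and "\<alpha> \<noteq> \<beta>"
    and fac: "(A - \<alpha> *\<^sub>R mat 1) ** (A - \<beta> *\<^sub>R mat 1) = 0"
    and "A \<noteq> \<alpha> *\<^sub>R mat 1" "A \<noteq> \<beta> *\<^sub>R mat 1"
  obtains r s n where "norm n = 1" "A = r *\<^sub>R mat 1 + s *\<^sub>R tensor_sq n"
proof -
  have fac': "(A - \<beta> *\<^sub>R mat 1) ** (A - \<alpha> *\<^sub>R mat 1) = 0"
    using fac by (simp add: matrix_mult.diff_left matrix_mult.diff_right matrix_mult.scaleR_left
        matrix_mult.scaleR_right algebra_simps)
  obtain n where n: "norm n = 1" "A *v n = \<alpha> *\<^sub>R n"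
    using eigenvector_from_factor[OF fac assms(5)] .
  obtain p where p: "norm p = 1" "A *v p = \<beta> *\<^sub>R p"
    using eigenvector_from_factor[OF fac' assms(4)] .
  have np: "n \<bullet> p = 0"
    using symmetric_dot[OF sym, of n p] n p \<open>\<alpha> \<noteq> \<beta>\<close> by simp
  define m where "m = cross3 n p"
  have m: "norm m = 1"
  proof -
    have "(norm m)\<^sup>2 = 1"
      using norm_cross_dot[of n p] n p np by (simp add: m_def)
    then show ?thesis
      by (simp add: power2_eq_1_iff) (smt (verit) norm_ge_zero)
  qed
  have mn: "m \<bullet> n = 0" "m \<bullet> p = 0"
    by (simp_all add: m_def inner_commute dot_cross_self)
  define l where "l = (A *v m) \<bullet> m"
  have Am: "A *v m = l *\<^sub>R m"
  proof -
    have "A *v m - l *\<^sub>R m = 0"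
    proof (rule zero_if_orthogonal_to_cross_frame[OF n(1) p(1) np])
      show "(A *v m - l *\<^sub>R m) \<bullet> n = 0" "(A *v m - l *\<^sub>R m) \<bullet> p = 0"
        by (simp_all add: inner_diff_left symmetric_dot[OF sym] n p mn)
      show "(A *v m - l *\<^sub>R m) \<bullet> cross3 n p = 0"
        using m by (simp add: inner_diff_left l_def flip: m_def power2_norm_eq_inner)
    qed
    then show ?thesis by simp
  qed
  have "((A - \<alpha> *\<^sub>R mat 1) ** (A - \<beta> *\<^sub>R mat 1)) *v m = ((l - \<alpha>) * (l - \<beta>)) *\<^sub>R m"
    by (simp add: matrix_vector_mult_diff_rdistrib Am matrix_vector_mult_scaleR algebra_simps
        flip: scaleR_matrix_vector_assoc matrix_vector_mul_assoc)
  then have l: "l = \<alpha> \<or> l = \<beta>"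
    using fac m by auto
  \<comment> \<open>A symmetric matrix is determined by its action on the frame.\<close>
  have expand: "A = B" if "A *v n = B *v n" "A *v m = B *v m" "A *v p = B *v p" "transpose B = B" for B
  proof -
    have "(A - B) *v x = 0" for x
    proof (rule zero_if_orthogonal_to_cross_frame[OF n(1) p(1) np])
      have symD: "transpose (A - B) = A - B"
        using sym that by (simp add: transpose_linear_simps)
      show "((A - B) *v x) \<bullet> n = 0" "((A - B) *v x) \<bullet> p = 0" "((A - B) *v x) \<bullet> cross3 n p = 0"
        unfolding symmetric_dot[OF symD] m_def[symmetric]
        by (simp_all add: matrix_vector_mult_diff_rdistrib that)
    qed
    then show ?thesis by (metis matrix_eq matrix_vector_mult_0 eq_iff_diff_eq_0)
  qed
  have symT: "transpose (r *\<^sub>R mat 1 + s *\<^sub>R tensor_sq v) = r *\<^sub>R mat 1 + s *\<^sub>R tensor_sq v"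
    for r s and v :: "real^3"
    by (simp add: transpose_linear_simps transpose_tensor_sq)
  have dots: "n \<bullet> n = 1" "p \<bullet> p = 1" "n \<bullet> m = 0" "p \<bullet> m = 0" "p \<bullet> n = 0"
    using n p np mn by (simp_all add: inner_commute flip: power2_norm_eq_inner)
  from l show ?thesis
  proof
    assume "l = \<alpha>"
    then have "A = \<alpha> *\<^sub>R mat 1 + (\<beta> - \<alpha>) *\<^sub>R tensor_sq p"
      by (intro expand symT) (simp_all add: matrix_vector_mult_add_rdistrib n p Am tensor_sq_mult
          dots algebra_simps flip: scaleR_matrix_vector_assoc)
    with p(1) show ?thesis by (rule that)
  next
    assume "l = \<beta>"
    then have "A = \<beta> *\<^sub>R mat 1 + (\<alpha> - \<beta>) *\<^sub>R tensor_sq n"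
      by (intro expand symT) (simp_all add: matrix_vector_mult_add_rdistrib n p Am tensor_sq_mult
          dots np algebra_simps flip: scaleR_matrix_vector_assoc)
    with n(1) show ?thesis by (rule that)
  qed
qed

text \<open>
  For \<open>b \<noteq> 0\<close> a vanishing gradient says that \<open>Q\<close> is a root of the quadratic polynomial
  \<open>x\<^sup>2 - e x - q\<close> with \<open>e = (a + c |Q|\<^sup>2) / b\<close> and \<open>q = |Q|\<^sup>2 / 3\<close>. If \<open>Q \<noteq> 0\<close> its roots have product \<open>- q < 0\<close>,
  so they are real, distinct and nonzero; as \<open>Q\<close> is traceless it is not a multiple of the identity,
  and both roots are eigenvalues. The trace condition then fixes the multiple of the identity.
\<close>

lemma stationary_point_uniaxial:
  assumes "b \<noteq> 0" and "Q \<in> stationary_points a b c"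
  obtains s n where "norm n = 1" "Q = s *\<^sub>R (tensor_sq n - (1 / 3) *\<^sub>R mat 1)"
proof (cases "Q = 0")
  case True
  then show ?thesis by (intro that[of "axis 1 1" 0]) simp_all
next
  case False
  have sym: "transpose Q = Q" and tr: "trace Q = 0" and grad: "gradF a b c Q = 0"
    using assms(2) by (auto simp: stationary_points_def sym_traceless_def)
  define q where "q = (norm Q)\<^sup>2 / 3"
  have "q > 0" using False by (simp add: q_def)
  define e where "e = (a + c * (norm Q)\<^sup>2) / b"
  define \<alpha> where "\<alpha> = (e + sqrt (e\<^sup>2 + 4 * q)) / 2"
  define \<beta> where "\<beta> = (e - sqrt (e\<^sup>2 + 4 * q)) / 2"
  have sum: "\<alpha> + \<beta> = e"
    by (simp add: \<alpha>_def \<beta>_def field_simps)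
  have "(sqrt (e\<^sup>2 + 4 * q))\<^sup>2 = e\<^sup>2 + 4 * q"
    using \<open>q > 0\<close> by simp
  then have prod: "\<alpha> * \<beta> = - q"
    unfolding \<alpha>_def \<beta>_def by (simp add: algebra_simps power2_eq_square)
  have "b *\<^sub>R (Q ** Q) = b *\<^sub>R (e *\<^sub>R Q + q *\<^sub>R mat 1)"
  proof -
    have "b * e = a + c * (norm Q)\<^sup>2"
      using \<open>b \<noteq> 0\<close> by (simp add: e_def)
    then show ?thesis
      using grad by (simp add: gradF_def q_def scaleR_add_right scaleR_add_left algebra_simps)
  qed
  then have sq: "Q ** Q = e *\<^sub>R Q + q *\<^sub>R mat 1"
    using \<open>b \<noteq> 0\<close> by simp
  have fac: "(Q - \<alpha> *\<^sub>R mat 1) ** (Q - \<beta> *\<^sub>R mat 1) = 0"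
  proof -
    have "(Q - \<alpha> *\<^sub>R mat 1) ** (Q - \<beta> *\<^sub>R mat 1) = Q ** Q - (\<alpha> + \<beta>) *\<^sub>R Q + (\<alpha> * \<beta>) *\<^sub>R mat 1"
      by (simp add: matrix_mult.diff_left matrix_mult.diff_right matrix_mult.scaleR_left
          matrix_mult.scaleR_right algebra_simps)
    then show ?thesis by (simp add: sum prod sq)
  qed
  have not_scalar: "Q \<noteq> r *\<^sub>R mat 1" if "r \<noteq> 0" for r
    using tr that by (auto simp: trace_scaleR trace_I)
  have nz: "\<alpha> \<noteq> 0" "\<beta> \<noteq> 0" "\<alpha> \<noteq> \<beta>"
    using prod \<open>q > 0\<close> by (auto) (smt (verit) zero_le_square)
  obtain r s n where n: "norm n = 1" and Qn: "Q = r *\<^sub>R mat 1 + s *\<^sub>R tensor_sq n"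
    using two_eigenvalues_rank_one_perturbation[OF sym nz(3) fac not_scalar[OF nz(1)] not_scalar[OF nz(2)]] .
  have "r = - (s / 3)"
    using tr trace_tensor_sq[OF n] by (simp add: Qn trace_add trace_scaleR trace_I)
  then show ?thesis
    by (intro that[OF n, of s]) (simp add: Qn algebra_simps)
qed

text \<open>
  The matrix \<open>T = n \<otimes> n - I / 3\<close> satisfies \<open>T\<^sup>2 = T / 3 + 2 I / 9\<close> and \<open>|T|\<^sup>2 = 2 / 3\<close>, so on the line spanned by
  \<open>T\<close> the gradient reduces to a scalar cubic, whose nonzero roots are those of a quadratic with
  discriminant \<open>b\<^sup>2 - 24 a c\<close>.
\<close>

lemma gradF_uniaxial:
  fixes n :: "real^3"
  assumes n: "norm n = 1"
  defines "T \<equiv> tensor_sq n - (1 / 3) *\<^sub>R mat 1"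
  shows "gradF a b c (s *\<^sub>R T) = (s / 3 * (2 * c * s\<^sup>2 - b * s + 3 * a)) *\<^sub>R T" and "T \<noteq> 0"
proof -
  have symT: "transpose T = T"
    by (simp add: T_def transpose_linear_simps transpose_tensor_sq)
  have sq: "T ** T = (1 / 3) *\<^sub>R T + (2 / 9) *\<^sub>R mat 1"
    by (simp add: T_def matrix_mult.diff_left matrix_mult.diff_right matrix_mult.scaleR_left
        matrix_mult.scaleR_right tensor_sq_idem n algebra_simps)
      (simp add: vec_eq_iff)
  have nT: "(norm T)\<^sup>2 = 2 / 3"
    unfolding norm_sq_eq_trace[OF symT] sq
    by (simp add: T_def trace_add trace_sub trace_scaleR trace_I trace_tensor_sq[OF n])
  then show "T \<noteq> 0" by auto
  have "gradF a b c (s *\<^sub>R T) =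
      (a * s) *\<^sub>R T - b *\<^sub>R (s\<^sup>2 *\<^sub>R (T ** T) - (s\<^sup>2 * (norm T)\<^sup>2 / 3) *\<^sub>R mat 1)
        + (c * s * (s\<^sup>2 * (norm T)\<^sup>2)) *\<^sub>R T"
    by (simp add: gradF_def matrix_mult.scaleR_left matrix_mult.scaleR_right power_mult_distrib
        mult_ac) (simp add: power2_eq_square)
  also have "\<dots> = (s / 3 * (2 * c * s\<^sup>2 - b * s + 3 * a)) *\<^sub>R T"
    unfolding nT sq by (simp add: vec_eq_iff field_simps power2_eq_square)
  finally show "gradF a b c (s *\<^sub>R T) = (s / 3 * (2 * c * s\<^sup>2 - b * s + 3 * a)) *\<^sub>R T" .
qed

text \<open>
  Completing the square.
\<close>

lemma stationary_amplitude:
  fixes a b c s :: real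
  assumes "c > 0" and "b\<^sup>2 - 24 * a * c > 0" and "s * (2 * c * s\<^sup>2 - b * s + 3 * a) = 0"
  shows "s \<in> {0, (b + sqrt (b\<^sup>2 - 24 * a * c)) / (4 * c), (b - sqrt (b\<^sup>2 - 24 * a * c)) / (4 * c)}"
proof (cases "s = 0")
  case False
  then have "(4 * c * s - b)\<^sup>2 = b\<^sup>2 - 24 * a * c + 8 * c * (2 * c * s\<^sup>2 - b * s + 3 * a)"
    by (simp add: power2_eq_square algebra_simps)
  also have "\<dots> = (sqrt (b\<^sup>2 - 24 * a * c))\<^sup>2"
    using False assms by simp
  finally have "4 * c * s - b = sqrt (b\<^sup>2 - 24 * a * c) \<or> 4 * c * s - b = - sqrt (b\<^sup>2 - 24 * a * c)"
    by (simp only: power2_eq_iff)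
  then show ?thesis
    using \<open>c > 0\<close> by (auto simp: field_simps)
qed simp

section \<open>Differential inequalities on the half-line\<close>

lemma increment_le_of_derivative_le:
  fixes \<phi> :: "real \<Rightarrow> real"
  assumes "0 \<le> x" "x \<le> y"
    and "\<And>t. x \<le> t \<Longrightarrow> t \<le> y \<Longrightarrow> (\<phi> has_real_derivative \<phi>' t) (at t within {0..})"
    and "\<And>t. x \<le> t \<Longrightarrow> t \<le> y \<Longrightarrow> \<phi>' t \<le> D"
  shows "\<phi> y - \<phi> x \<le> D * (y - x)"
proof -
  have "\<exists>t\<in>{x..y}. \<phi> y - \<phi> x = \<phi>' t * (y - x)"
  proof (rule mvt_very_simple[OF assms(2)])
    fix t assume "x \<le> t" "t \<le> y"
    then have "(\<phi> has_real_derivative \<phi>' t) (at t within {x..y})"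
      using assms(1) by (intro DERIV_subset[OF assms(3)]) auto
    then show "(\<phi> has_derivative (*) (\<phi>' t)) (at t within {x..y})"
      by (simp add: has_field_derivative_def)
  qed
  then show ?thesis
    using assms by (auto intro!: mult_right_mono)
qed

text \<open>
  Gronwall's argument: \<open>|K|\<^sup>2 exp (- 2 C t)\<close> is nonnegative, nonincreasing and starts at zero.
\<close>

lemma zero_if_linearly_bounded_derivative:
  fixes K :: "real \<Rightarrow> 'a::real_inner"
  assumes K': "\<And>t. 0 \<le> t \<Longrightarrow> (K has_vector_derivative K' t) (at t within {0..})"
    and bound: "\<And>t. 0 \<le> t \<Longrightarrow> norm (K' t) \<le> C * norm (K t)"
    and "K 0 = 0" and "0 \<le> t"
  shows "K t = 0"
proof -
  define \<phi> where "\<phi> t = (K t \<bullet> K t) * exp (- 2 * C * t)" for t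
  define \<phi>' where "\<phi>' t = 2 * (K t \<bullet> K' t - C * (K t \<bullet> K t)) * exp (- 2 * C * t)" for t
  have "\<phi> t - \<phi> 0 \<le> 0 * (t - 0)"
  proof (rule increment_le_of_derivative_le[where \<phi>' = \<phi>'])
    fix u :: real assume u: "0 \<le> u"
    have "((\<lambda>t. K t \<bullet> K t) has_real_derivative 2 * (K u \<bullet> K' u)) (at u within {0..})"
      using bounded_bilinear.has_vector_derivative[OF bounded_bilinear_inner K'[OF u] K'[OF u]]
      by (simp add: has_real_derivative_iff_has_vector_derivative inner_commute)
    then show "(\<phi> has_real_derivative \<phi>' u) (at u within {0..})"
      unfolding \<phi>_def \<phi>'_def by (auto intro!: derivative_eq_intros simp: algebra_simps)
    have "K u \<bullet> K' u \<le> norm (K u) * norm (K' u)"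
      by (rule norm_cauchy_schwarz)
    also have "\<dots> \<le> norm (K u) * (C * norm (K u))"
      by (intro mult_left_mono bound u) simp
    also have "\<dots> = C * (K u \<bullet> K u)"
      by (simp add: power2_eq_square flip: power2_norm_eq_inner)
    finally show "\<phi>' u \<le> 0"
      by (simp add: \<phi>'_def mult_le_0_iff)
  qed (use \<open>0 \<le> t\<close> in auto)
  then have "K t \<bullet> K t \<le> 0"
    using \<open>K 0 = 0\<close> by (simp add: \<phi>_def mult_le_0_iff)
  then show ?thesis
    by (metis inner_eq_zero_iff inner_ge_zero order_antisym)
qed

section \<open>Energy dissipation and omega-limit points\<close>

lemma continuous_on_trace [continuous_intros]:
  fixes f :: "'a::topological_space \<Rightarrow> real^'n^'n"
  shows "continuous_on S f \<Longrightarrow> continuous_on S (\<lambda>x. trace (f x))"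
  unfolding trace_def by (intro continuous_intros)

lemma continuous_on_F: "continuous_on S (F a b c)"
  unfolding F_def[abs_def] by (intro continuous_intros matrix_mult.continuous_on ballI) simp_all

lemma continuous_on_gradF: "continuous_on S (gradF a b c)"
  unfolding gradF_def[abs_def] by (intro continuous_intros matrix_mult.continuous_on ballI) simp_all

lemma closed_sym_traceless: "closed sym_traceless"
proof -
  have "continuous_on UNIV (transpose :: real^3^3 \<Rightarrow> _)"
    by (rule linear_continuous_on[OF bounded_linear_transpose])
  then have "closed ({Q. transpose Q = Q} \<inter> {Q :: real^3^3. trace Q = 0})"
    by (intro closed_Int closed_Collect_eq continuous_intros)
  then show ?thesis
    by (simp add: sym_traceless_def Collect_conj_eq)
qed

text \<open>
  The quartic term has a positive coefficient and dominates: the cubic and quadratic terms and the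
  level \<open>E\<close> are all at most a constant times \<open>|Q|\<^sup>3\<close> once \<open>|Q| \<ge> 1\<close>.
\<close>

lemma F_coercive:
  assumes "c > 0"
  obtains R where "\<And>Q. Q \<in> sym_traceless \<Longrightarrow> F a b c Q \<le> E \<Longrightarrow> norm Q \<le> R"
proof -
  obtain k where k: "0 \<le> k" "\<And>(A :: real^3^3) (B :: real^3^3). norm (A ** B) \<le> norm A * norm B * k"
    using matrix_mult.nonneg_bounded by blast
  define S where "S = \<bar>a\<bar> / 2 + \<bar>b\<bar> / 3 * k + \<bar>E\<bar>"
  define R where "R = max 1 (4 / c * S)"
  have "norm Q \<le> R" if Q: "Q \<in> sym_traceless" and FE: "F a b c Q \<le> E" for Q
  proof (rule ccontr)
    define r where "r = norm Q"
    assume "\<not> norm Q \<le> R"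
    then have r: "r > 1" "r > 4 / c * S"
      by (auto simp: r_def R_def)
    have sym: "transpose Q = Q"
      using Q by (simp add: sym_traceless_def)
    have tr2: "trace (Q ** Q) = r\<^sup>2"
      by (simp add: r_def norm_sq_eq_trace sym)
    have "\<bar>trace (Q ** Q ** Q)\<bar> = \<bar>Q \<bullet> (Q ** Q)\<bar>"
      by (simp add: inner_eq_trace sym matrix_mul_assoc)
    also have "\<dots> \<le> norm Q * norm (Q ** Q)"
      by (rule Cauchy_Schwarz_ineq2)
    also have "\<dots> \<le> norm Q * (norm Q * norm Q * k)"
      by (intro mult_left_mono k) simp
    finally have tr3: "\<bar>trace (Q ** Q ** Q)\<bar> \<le> k * r ^ 3"
      by (simp add: r_def power3_eq_cube mult_ac)
    have pow: "r\<^sup>2 \<le> r ^ 3" "1 \<le> r ^ 3"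
      using r(1) by (auto intro: power_increasing one_le_power)
    have "- (a / 2 * r\<^sup>2) \<le> \<bar>a\<bar> / 2 * r ^ 3"
    proof -
      have "- (a / 2 * r\<^sup>2) \<le> \<bar>a\<bar> / 2 * r\<^sup>2"
        using mult_right_mono[of "- a / 2" "\<bar>a\<bar> / 2" "r\<^sup>2"] by simp
      also have "\<dots> \<le> \<bar>a\<bar> / 2 * r ^ 3"
        by (intro mult_left_mono pow) simp
      finally show ?thesis .
    qed
    moreover have "b / 3 * trace (Q ** Q ** Q) \<le> \<bar>b\<bar> / 3 * k * r ^ 3"
    proof -
      have "b / 3 * trace (Q ** Q ** Q) \<le> \<bar>b / 3 * trace (Q ** Q ** Q)\<bar>"
        by (rule abs_ge_self)
      also have "\<dots> = \<bar>b\<bar> / 3 * \<bar>trace (Q ** Q ** Q)\<bar>"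
        by (simp add: abs_mult)
      also have "\<dots> \<le> \<bar>b\<bar> / 3 * (k * r ^ 3)"
        by (intro mult_left_mono tr3) simp
      finally show ?thesis by (simp add: mult_ac)
    qed
    moreover have "E \<le> \<bar>E\<bar> * r ^ 3"
      using mult_left_mono[OF pow(2), of "\<bar>E\<bar>"] by simp
    ultimately have "c / 4 * (r\<^sup>2)\<^sup>2 \<le> S * r ^ 3"
      using FE unfolding F_def tr2 S_def by (simp add: algebra_simps)
    moreover have "S * r ^ 3 < c / 4 * r * r ^ 3"
      using r \<open>c > 0\<close> by (intro mult_strict_right_mono) (auto simp: field_simps)
    ultimately show False
      by (simp add: power2_eq_square power3_eq_cube mult_ac)
  qed
  then show ?thesis by (rule that)
qed

context
  fixes a b c :: real and V :: "real \<Rightarrow> real^3^3"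
  assumes c: "c > 0" and V: "ode_solution (\<lambda>M. - gradF a b c M) V"
begin

lemma flow_sym_traceless: "0 \<le> t \<Longrightarrow> V t \<in> sym_traceless"
  and flow_derivative: "0 \<le> t \<Longrightarrow> (V has_vector_derivative - gradF a b c (V t)) (at t within {0..})"
  using V by (auto simp: ode_solution_def)

text \<open>
  The formula for the gradient is only valid along symmetric traceless directions, which is why the
  chain rule is applied with the derivative of \<open>F\<close> within the range of the trajectory.
\<close>

lemma energy_dissipation:
  assumes "0 \<le> t"
  shows "((\<lambda>t. F a b c (V t)) has_real_derivative - (norm (gradF a b c (V t)))\<^sup>2) (at t within {0..})"
proof -
  have "(F a b c has_derivative (\<lambda>H. gradF a b c (V t) \<bullet> H)) (at (V t) within V ` {0..})"
    by (rule has_derivative_subset[OF gradF_is_gradient(2)]) (auto simp: flow_sym_traceless assms)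
  from diff_chain_within[OF flow_derivative[OF assms, unfolded has_vector_derivative_def] this]
  have "((\<lambda>t. F a b c (V t)) has_derivative (\<lambda>h. gradF a b c (V t) \<bullet> (h *\<^sub>R - gradF a b c (V t))))
      (at t within {0..})"
    by (simp only: o_def)
  then show ?thesis
    unfolding has_field_derivative_def
    by (rule has_derivative_eq_rhs) (simp add: fun_eq_iff power2_norm_eq_inner)
qed

lemma energy_increment:
  assumes "0 \<le> x" "x \<le> y" and "\<And>t. x \<le> t \<Longrightarrow> t \<le> y \<Longrightarrow> m \<le> (norm (gradF a b c (V t)))\<^sup>2"
  shows "F a b c (V y) \<le> F a b c (V x) - m * (y - x)"
  using increment_le_of_derivative_le[OF assms(1,2), where \<phi>="\<lambda>t. F a b c (V t)" and D="-m"
      and \<phi>'="\<lambda>t. - (norm (gradF a b c (V t)))\<^sup>2"] energy_dissipation assms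
  by force

text \<open>
  The trajectory stays in the sublevel set of its initial energy.
\<close>

lemma flow_bounded:
  obtains R where "\<And>t. 0 \<le> t \<Longrightarrow> norm (V t) \<le> R"
proof -
  obtain R where R: "\<And>Q. Q \<in> sym_traceless \<Longrightarrow> F a b c Q \<le> F a b c (V 0) \<Longrightarrow> norm Q \<le> R"
    using F_coercive[OF c] by blast
  have "norm (V t) \<le> R" if "0 \<le> t" for t
    using energy_increment[of 0 t 0] that by (intro R flow_sym_traceless) auto
  then show ?thesis by (rule that)
qed

text \<open>
  A bounded trajectory sees only bounded values of the continuous gradient. This gives a time step
  \<open>\<tau>\<close>, the same for all starting times, during which the trajectory cannot leave a given
  neighbourhood.
\<close>

lemma flow_speed_bounded:
  obtains M where "M > 0" "\<And>x y. 0 \<le> x \<Longrightarrow> x \<le> y \<Longrightarrow> norm (V y - V x) \<le> M * (y - x)"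
proof -
  obtain R where R: "\<And>t. 0 \<le> t \<Longrightarrow> norm (V t) \<le> R"
    using flow_bounded by blast
  have "compact (gradF a b c ` cball 0 R)"
    by (intro compact_continuous_image continuous_on_gradF compact_cball)
  then obtain M where M: "M > 0" "\<And>Q. norm Q \<le> R \<Longrightarrow> norm (gradF a b c Q) \<le> M"
    unfolding bounded_pos[of "gradF a b c ` cball 0 R"] using compact_imp_bounded
    by (metis bounded_pos image_eqI mem_cball_0)
  have "norm (V y - V x) \<le> M * (y - x)" if x: "0 \<le> x" and xy: "x \<le> y" for x y
  proof (cases "x = y")
    case False
    then have "x < y" using xy by simp
    have "continuous_on {x..y} V"
      using x by (intro continuous_on_vector_derivative[where f' = "\<lambda>t. - gradF a b c (V t)"]
          has_vector_derivative_within_subset[OF flow_derivative]) auto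
    moreover have "(V has_derivative (\<lambda>h. h *\<^sub>R - gradF a b c (V t))) (at t)"
      if "x < t" "t < y" for t
    proof -
      have "at t within {0..} = at t"
        using that x by (intro at_within_interior) auto
      then show ?thesis
        using flow_derivative[of t] that x by (simp add: has_vector_derivative_def)
    qed
    ultimately obtain t where t: "t \<in> {x<..<y}"
        "norm (V y - V x) \<le> norm ((y - x) *\<^sub>R - gradF a b c (V t))"
      using mvt_general[OF \<open>x < y\<close>, of V "\<lambda>t h. h *\<^sub>R - gradF a b c (V t)"] by blast
    have "norm (gradF a b c (V t)) \<le> M"
      using t x by (intro M R) auto
    then have "norm (gradF a b c (V t)) * (y - x) \<le> M * (y - x)"
      using xy by (intro mult_right_mono) auto
    moreover have "norm ((y - x) *\<^sub>R - gradF a b c (V t)) = norm (gradF a b c (V t)) * (y - x)"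
      using xy by simp
    ultimately show ?thesis using t(2) by linarith
  qed simp
  with M(1) show ?thesis by (rule that)
qed

text \<open>
  Since \<open>F\<close> does not increase, \<open>F (L)\<close> is a lower bound for the energy of the whole trajectory. If the
  gradient at \<open>L\<close> were nonzero, each visit of the trajectory to a neighbourhood of \<open>L\<close> would cost a
  fixed amount of energy \<open>m \<tau>\<close>; a visit that starts with energy below \<open>F (L) + m \<tau>\<close> would end
  below \<open>F (L)\<close>.
\<close>

lemma omega_limit_stationary: "omega_limit_set V \<subseteq> stationary_points a b c"
proof
  fix L assume "L \<in> omega_limit_set V"
  then obtain t where t: "filterlim t at_top sequentially" and L: "(\<lambda>k. V (t k)) \<longlonglongrightarrow> L"
    by (auto simp: omega_limit_set_def)
  have t_ge: "eventually (\<lambda>k. x \<le> t k) sequentially" for x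
    using t by (simp add: filterlim_at_top)
  have "L \<in> sym_traceless"
    using closed_sym_traceless _ trivial_limit_sequentially L
    by (rule Lim_in_closed_set) (use t_ge[of 0] flow_sym_traceless in \<open>auto elim: eventually_mono\<close>)
  have FL: "(\<lambda>k. F a b c (V (t k))) \<longlonglongrightarrow> F a b c L"
    using continuous_on_tendsto_compose[OF continuous_on_F[of UNIV] L] by simp
  have lower: "F a b c L \<le> F a b c (V x)" if "0 \<le> x" for x
  proof (rule tendsto_upperbound[OF FL _ trivial_limit_sequentially])
    show "\<forall>\<^sub>F k in sequentially. F a b c (V (t k)) \<le> F a b c (V x)"
      using t_ge[of x] by eventually_elim (use energy_increment[of x _ 0] that in auto)
  qed
  have "gradF a b c L = 0"
  proof (rule ccontr)
    assume nz: "gradF a b c L \<noteq> 0"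
    define m where "m = (norm (gradF a b c L))\<^sup>2 / 2"
    have m: "m > 0" "m < (norm (gradF a b c L))\<^sup>2"
      using nz by (auto simp: m_def)
    have "isCont (gradF a b c) L"
      using continuous_on_gradF[of UNIV] by (simp add: continuous_on_eq_continuous_at)
    then have "isCont (\<lambda>X. (norm (gradF a b c X))\<^sup>2) L"
      by (intro continuous_intros)
    then have "\<forall>\<^sub>F X in nhds L. m < (norm (gradF a b c X))\<^sup>2"
      unfolding isCont_def
        tendsto_at_iff_tendsto_nhds[of "\<lambda>X. (norm (gradF a b c X))\<^sup>2" L]
      using m(2) by (rule order_tendstoD(1))
    then obtain \<delta> where \<delta>: "\<delta> > 0" "\<And>X. dist X L < \<delta> \<Longrightarrow> m < (norm (gradF a b c X))\<^sup>2"
      by (auto simp: eventually_nhds_metric)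
    obtain M where M: "M > 0" "\<And>x y. 0 \<le> x \<Longrightarrow> x \<le> y \<Longrightarrow> norm (V y - V x) \<le> M * (y - x)"
      using flow_speed_bounded by blast
    \<comment> \<open>At speed at most \<open>M\<close>, starting in the ball of radius \<open>\<delta> / 2\<close>, the trajectory remains in the
      ball of radius \<open>\<delta>\<close> for time \<open>\<tau>\<close>.\<close>
    define \<tau> where "\<tau> = \<delta> / (2 * M)"
    have \<tau>: "\<tau> > 0" "M * \<tau> = \<delta> / 2"
      using \<delta>(1) M(1) by (auto simp: \<tau>_def)
    have "\<forall>\<^sub>F k in sequentially. dist (V (t k)) L < \<delta> / 2"
      using L \<delta>(1) by (intro tendstoD) auto
    moreover have "\<forall>\<^sub>F k in sequentially. F a b c (V (t k)) < F a b c L + m * \<tau>"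
      using FL m(1) \<tau>(1) by (intro order_tendstoD) auto
    ultimately have "\<forall>\<^sub>F k in sequentially. 0 \<le> t k \<and> dist (V (t k)) L < \<delta> / 2 \<and>
        F a b c (V (t k)) < F a b c L + m * \<tau>"
      using t_ge[of 0] by eventually_elim auto
    then obtain k where k: "0 \<le> t k" "dist (V (t k)) L < \<delta> / 2"
        "F a b c (V (t k)) < F a b c L + m * \<tau>"
      using eventually_happens'[OF sequentially_bot] by blast
    have "F a b c (V (t k + \<tau>)) \<le> F a b c (V (t k)) - m * (t k + \<tau> - t k)"
    proof (rule energy_increment[OF k(1)])
      fix u assume u: "t k \<le> u" "u \<le> t k + \<tau>"
      have "norm (V u - V (t k)) \<le> M * (u - t k)"
        by (rule M(2)[OF k(1) u(1)])
      also have "\<dots> \<le> M * \<tau>"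
        using u M(1) by (intro mult_left_mono) auto
      finally have "dist (V u) L < \<delta>"
        using k(2) \<tau>(2) dist_triangle[of "V u" L "V (t k)"] by (simp add: dist_norm)
      then show "m \<le> (norm (gradF a b c (V u)))\<^sup>2"
        using \<delta>(2) by (intro less_imp_le)
    qed (use \<tau> in auto)
    then show False
      using k lower[of "t k + \<tau>"] \<tau> by auto
  qed
  with \<open>L \<in> sym_traceless\<close> show "L \<in> stationary_points a b c"
    by (simp add: stationary_points_def)
qed

section \<open>Conservation of eigenvectors\<close>

text \<open>
  The commutator \<open>K = [V, N]\<close> obeys a linear equation: \<open>[V, N]\<close> factors out of \<open>[V\<^sup>2, N] = V K + K V\<close>, and
  \<open>[I, N] = 0\<close>. Its coefficients are bounded because \<open>V\<close> is, so \<open>K\<close> vanishes if it does initially.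
\<close>

lemma flow_preserves_commutation:
  assumes "V 0 ** N = N ** V 0" and "0 \<le> t"
  shows "V t ** N = N ** V t"
proof -
  obtain R where R: "\<And>t. 0 \<le> t \<Longrightarrow> norm (V t) \<le> R"
    using flow_bounded by blast
  obtain k where k: "0 \<le> k" "\<And>(A :: real^3^3) (B :: real^3^3). norm (A ** B) \<le> norm A * norm B * k"
    using matrix_mult.nonneg_bounded by blast
  define K where "K t = V t ** N - N ** V t" for t
  define K' where "K' t = b *\<^sub>R (V t ** K t + K t ** V t) - (a + c * (norm (V t))\<^sup>2) *\<^sub>R K t" for t
  have "K t = 0"
  proof (rule zero_if_linearly_bounded_derivative[where K' = K' and C = "\<bar>b\<bar> * (2 * R * k) + (\<bar>a\<bar> + c * R\<^sup>2)"])
    fix t :: real assume t: "0 \<le> t"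
    have "(K has_vector_derivative - gradF a b c (V t) ** N - N ** - gradF a b c (V t)) (at t within {0..})"
      unfolding K_def
      by (intro has_vector_derivative_diff flow_derivative t
          bounded_linear.has_vector_derivative[OF matrix_mult.bounded_linear_left]
          bounded_linear.has_vector_derivative[OF matrix_mult.bounded_linear_right])
    moreover have "- gradF a b c (V t) ** N - N ** - gradF a b c (V t) = K' t"
      by (simp add: gradF_def K'_def K_def matrix_mult.add_left matrix_mult.add_right
          matrix_mult.diff_left matrix_mult.diff_right matrix_mult.minus_left matrix_mult.minus_right
          matrix_mult.scaleR_left matrix_mult.scaleR_right matrix_mul_assoc algebra_simps)
    ultimately show "(K has_vector_derivative K' t) (at t within {0..})"
      by simp
    have "norm (V t ** K t + K t ** V t) \<le> 2 * (norm (V t) * norm (K t) * k)"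
      using norm_triangle_ineq[of "V t ** K t" "K t ** V t"] k(2)[of "V t" "K t"] k(2)[of "K t" "V t"]
      by (simp add: mult_ac)
    also have "\<dots> \<le> 2 * (R * norm (K t) * k)"
      by (intro mult_left_mono mult_right_mono R t k(1)) auto
    finally have "\<bar>b\<bar> * norm (V t ** K t + K t ** V t) \<le> \<bar>b\<bar> * (2 * (R * norm (K t) * k))"
      by (rule mult_left_mono) simp
    then have 1: "norm (b *\<^sub>R (V t ** K t + K t ** V t)) \<le> \<bar>b\<bar> * (2 * R * k) * norm (K t)"
      by (simp add: mult_ac)
    have "\<bar>a + c * (norm (V t))\<^sup>2\<bar> \<le> \<bar>a\<bar> + c * (norm (V t))\<^sup>2"
      using c by (intro order_trans[OF abs_triangle_ineq]) (simp add: abs_mult)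
    also have "\<dots> \<le> \<bar>a\<bar> + c * R\<^sup>2"
      using c R[OF t] by (simp add: power_mono)
    finally have 2: "norm ((a + c * (norm (V t))\<^sup>2) *\<^sub>R K t) \<le> (\<bar>a\<bar> + c * R\<^sup>2) * norm (K t)"
      unfolding norm_scaleR by (rule mult_right_mono) simp
    have "norm (K' t) \<le> \<bar>b\<bar> * (2 * R * k) * norm (K t) + (\<bar>a\<bar> + c * R\<^sup>2) * norm (K t)"
      unfolding K'_def by (intro norm_triangle_le_diff add_mono 1 2)
    then show "norm (K' t) \<le> (\<bar>b\<bar> * (2 * R * k) + (\<bar>a\<bar> + c * R\<^sup>2)) * norm (K t)"
      by (simp only: distrib_right)
  qed (use assms in \<open>auto simp: K_def\<close>)
  then show ?thesis by (simp add: K_def)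
qed

end

text \<open>
  Being an eigenvector becomes a linear condition on \<open>A\<close> without reference to the eigenvalue, which
  may change along the flow and may coincide with others.
\<close>

lemma eigenvector_iff_commutes_tensor_sq:
  assumes sym: "transpose A = A" and v: "norm v = 1"
  shows "(\<exists>l. A *v v = l *\<^sub>R v) \<longleftrightarrow> A ** tensor_sq v = tensor_sq v ** A"
proof
  assume "\<exists>l. A *v v = l *\<^sub>R v"
  then obtain l where l: "A *v v = l *\<^sub>R v" by blast
  show "A ** tensor_sq v = tensor_sq v ** A"
    unfolding matrix_eq
  proof
    fix x
    have "v \<bullet> (A *v x) = l * (v \<bullet> x)"
      using symmetric_dot[OF sym, of v x] l by simp
    then show "(A ** tensor_sq v) *v x = (tensor_sq v ** A) *v x"
      by (simp add: tensor_sq_mult matrix_vector_mult_scaleR l flip: matrix_vector_mul_assoc)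
  qed
next
  assume *: "A ** tensor_sq v = tensor_sq v ** A"
  have "A *v v = A *v (tensor_sq v *v v)"
    using v by (simp add: tensor_sq_mult norm_eq_1)
  also have "\<dots> = (v \<bullet> (A *v v)) *\<^sub>R v"
    by (simp add: matrix_vector_mul_assoc *) (simp add: tensor_sq_mult flip: matrix_vector_mul_assoc)
  finally show "\<exists>l. A *v v = l *\<^sub>R v" ..
qed

section \<open>Asymptotics and eigenframe in the original frame\<close>

text \<open>
  Boundedness and compactness provide a limit point of the gradient flow, which is stationary and
  hence uniaxial with an admissible amplitude.
\<close>

lemma gradient_flow_uniaxial_limit:
  assumes c: "c > 0" and disc: "b\<^sup>2 - 24 * a * c > 0" and "b \<noteq> 0"
    and U: "ode_solution (\<lambda>M. - gradF a b c M) U"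
  obtains t :: "nat \<Rightarrow> real" and s and n :: "real^3"
  where "\<And>k. 0 \<le> t k" "filterlim t at_top sequentially" "norm n = 1"
    "s \<in> {0, (b + sqrt (b\<^sup>2 - 24 * a * c)) / (4 * c), (b - sqrt (b\<^sup>2 - 24 * a * c)) / (4 * c)}"
    "(\<lambda>k. U (t k)) \<longlonglongrightarrow> s *\<^sub>R (tensor_sq n - (1 / 3) *\<^sub>R mat 1)"
proof -
  obtain R where R: "\<And>t. 0 \<le> t \<Longrightarrow> norm (U t) \<le> R"
    using flow_bounded[OF c U] by blast
  have "bounded (range (\<lambda>k. U (real k)))"
    using R by (intro boundedI[where B = R]) auto
  then obtain L r where r: "strict_mono r" and L: "((\<lambda>k. U (real k)) \<circ> r) \<longlonglongrightarrow> L"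
    using bounded_imp_convergent_subsequence by blast
  define t where "t k = real (r k)" for k
  have t: "filterlim t at_top sequentially"
    unfolding t_def by (intro filterlim_compose[OF filterlim_real_sequentially] filterlim_subseq r)
  have UL: "(\<lambda>k. U (t k)) \<longlonglongrightarrow> L"
    using L by (simp add: o_def t_def)
  have stat: "L \<in> stationary_points a b c"
    using omega_limit_stationary[OF c U] t UL by (auto simp: omega_limit_set_def)
  then obtain s n where n: "norm n = 1" and Leq: "L = s *\<^sub>R (tensor_sq n - (1 / 3) *\<^sub>R mat 1)"
    using stationary_point_uniaxial[OF \<open>b \<noteq> 0\<close>] by blast
  have "s * (2 * c * s\<^sup>2 - b * s + 3 * a) = 0"
    using stat gradF_uniaxial(1)[OF n, of a b c s] gradF_uniaxial(2)[OF n] by (auto simp: stationary_points_def Leq)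
  from stationary_amplitude[OF c disc this] show ?thesis
    using UL t n by (intro that[of t n s]) (auto simp: t_def Leq)
qed

theorem proposition2p1:
  fixes a b c :: real
    and Q\<^sub>0 :: "real^3^3"
    and Q U :: "real \<Rightarrow> real^3^3"
  assumes "c > 0" and "b\<^sup>2 - 24 * a * c > 0"
    and "Q\<^sub>0 \<in> sym_traceless"
    and "ode_solution (\<lambda>M. commutator Wmat M - gradF a b c M) Q" and "Q 0 = Q\<^sub>0"
    and "\<And>t. 0 \<le> t \<Longrightarrow> U t = transpose (Bmat t) ** Q t ** Bmat t"
  shows
    "(\<forall>t. Bmat t =
        vector [vector [cos t, sin t, 0], vector [- sin t, cos t, 0], vector [0, 0, 1]]) \<and>
     (ode_solution (\<lambda>M. - gradF a b c M) U \<and>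
      (\<forall>V. ode_solution (\<lambda>M. - gradF a b c M) V \<longrightarrow>
           omega_limit_set V \<subseteq> stationary_points a b c)) \<and>
     (b \<noteq> 0 \<longrightarrow>
      (\<exists>(t :: nat \<Rightarrow> real) s (n :: real^3).
         (\<forall>k. 0 \<le> t k) \<and> filterlim t at_top sequentially \<and>
         s \<in> {0, (b + sqrt (b\<^sup>2 - 24 * a * c)) / (4 * c),
                 (b - sqrt (b\<^sup>2 - 24 * a * c)) / (4 * c)} \<and>
         norm n = 1 \<and>
         (let nt = (\<lambda>\<tau>. vector [n $ 1 * cos \<tau> + n $ 2 * sin \<tau>,
                                - (n $ 1) * sin \<tau> + n $ 2 * cos \<tau>, n $ 3] :: real^3)
          in (\<lambda>k. norm (Q (t k) - s *\<^sub>R (tensor_sq (nt (t k)) - (1 / 3) *\<^sub>R mat 1))) \<longlonglongrightarrow> 0))) \<and>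
     (\<forall>n m p. orthonormal_eigenvectors Q\<^sub>0 n m p \<longrightarrow>
        (\<forall>t\<ge>0. orthonormal_eigenvectors (Q t) (Bmat t *v n) (Bmat t *v m) (Bmat t *v p)))"
proof -
  note c = assms(1) and disc = assms(2) and Q = assms(4) and Q0 = assms(5) and U = assms(6)
  have flow: "ode_solution (\<lambda>M. - gradF a b c M) U"
    by (rule corotating_frame[OF Q U])
  have symQ: "transpose (Q t) = Q t" and symU: "transpose (U t) = U t" if "0 \<le> t" for t
    using Q flow that by (auto simp: ode_solution_def sym_traceless_def)
  have QU: "Q t = Bmat t ** U t ** transpose (Bmat t)" if "0 \<le> t" for t
  proof -
    have "Bmat t ** U t ** transpose (Bmat t) =
        (Bmat t ** transpose (Bmat t)) ** Q t ** (Bmat t ** transpose (Bmat t))"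
      by (simp add: U[OF that] matrix_mul_assoc)
    then show ?thesis by (simp add: Bmat_mult_transpose)
  qed
  \<comment> \<open>The rotation is an isometry that carries the fixed director of the limit of \<open>U\<close> to \<open>n(t)\<close>.\<close>
  have part2: "\<exists>(t :: nat \<Rightarrow> real) s (n :: real^3).
         (\<forall>k. 0 \<le> t k) \<and> filterlim t at_top sequentially \<and>
         s \<in> {0, (b + sqrt (b\<^sup>2 - 24 * a * c)) / (4 * c),
                 (b - sqrt (b\<^sup>2 - 24 * a * c)) / (4 * c)} \<and>
         norm n = 1 \<and>
         (let nt = (\<lambda>\<tau>. vector [n $ 1 * cos \<tau> + n $ 2 * sin \<tau>,
                                - (n $ 1) * sin \<tau> + n $ 2 * cos \<tau>, n $ 3] :: real^3)
          in (\<lambda>k. norm (Q (t k) - s *\<^sub>R (tensor_sq (nt (t k)) - (1 / 3) *\<^sub>R mat 1))) \<longlonglongrightarrow> 0)"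
    if b: "b \<noteq> 0"
  proof -
    obtain t s and n :: "real^3" where t: "\<And>k. 0 \<le> t k" "filterlim t at_top sequentially"
      and n: "norm n = 1"
      and s: "s \<in> {0, (b + sqrt (b\<^sup>2 - 24 * a * c)) / (4 * c), (b - sqrt (b\<^sup>2 - 24 * a * c)) / (4 * c)}"
      and lim: "(\<lambda>k. U (t k)) \<longlonglongrightarrow> s *\<^sub>R (tensor_sq n - (1 / 3) *\<^sub>R mat 1)"
      by (rule gradient_flow_uniaxial_limit[OF c disc b flow]) blast
    define L where "L = s *\<^sub>R (tensor_sq n - (1 / 3) *\<^sub>R mat 1)"
    have symL: "transpose L = L"
      by (simp add: L_def transpose_linear_simps transpose_tensor_sq)
    have nt: "vector [n $ 1 * cos \<tau> + n $ 2 * sin \<tau>, - (n $ 1) * sin \<tau> + n $ 2 * cos \<tau>, n $ 3]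
        = Bmat \<tau> *v n" for \<tau>
      by (simp add: Bmat_eq matrix_vector_mult_def vec_eq_iff forall_3 sum_3)
    have "norm (Q (t k) - s *\<^sub>R (tensor_sq (Bmat (t k) *v n) - (1 / 3) *\<^sub>R mat 1)) = norm (U (t k) - L)" for k
    proof -
      let ?B = "Bmat (t k)"
      have "Q (t k) - s *\<^sub>R (tensor_sq (?B *v n) - (1 / 3) *\<^sub>R mat 1) = ?B ** (U (t k) - L) ** transpose ?B"
        by (simp add: QU t(1) L_def tensor_sq_image matrix_mult.diff_left matrix_mult.diff_right
            matrix_mult.scaleR_left matrix_mult.scaleR_right Bmat_mult_transpose)
      then show ?thesis
        using orthogonal_conj_norm[of "transpose ?B" "U (t k) - L"] orthogonal_matrix_Bmat[of "t k"]
        by (simp add: transpose_linear_simps symL symU t(1))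
    qed
    moreover have "(\<lambda>k. norm (U (t k) - L)) \<longlonglongrightarrow> 0"
      using tendsto_norm_zero[OF LIM_zero[OF lim]] by (simp add: L_def)
    ultimately have "(\<lambda>k. norm (Q (t k) - s *\<^sub>R (tensor_sq (Bmat (t k) *v n) - (1 / 3) *\<^sub>R mat 1)))
        \<longlonglongrightarrow> 0"
      by simp
    then show ?thesis
      using t n s by (intro exI[of _ t] exI[of _ s] exI[of _ n]) (simp only: Let_def nt simp_thms)
  qed
  have part3: "orthonormal_eigenvectors (Q t) (Bmat t *v n) (Bmat t *v m) (Bmat t *v p)"
    if ev: "orthonormal_eigenvectors Q\<^sub>0 n m p" and t: "0 \<le> t" for n m p t
  proof -
    have "Bmat 0 = mat 1"
      by (simp add: Bmat_eq vec_eq_iff forall_3 mat_def)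
    then have U0: "U 0 = Q\<^sub>0"
      using U[of 0] Q0 by simp
    have "\<exists>l. Q t *v (Bmat t *v v) = l *\<^sub>R (Bmat t *v v)"
      if v: "norm v = 1" and v_ev: "\<exists>l. Q\<^sub>0 *v v = l *\<^sub>R v" for v
    proof -
      have "U 0 ** tensor_sq v = tensor_sq v ** U 0"
        using eigenvector_iff_commutes_tensor_sq[OF symU[of 0] v] v_ev by (simp add: U0)
      from flow_preserves_commutation[OF c flow this t] obtain l where l: "U t *v v = l *\<^sub>R v"
        using eigenvector_iff_commutes_tensor_sq[OF symU[OF t] v] by blast
      have "Q t *v (Bmat t *v v) = Bmat t *v (U t *v ((transpose (Bmat t) ** Bmat t) *v v))"
        by (simp add: QU[OF t] matrix_vector_mul_assoc matrix_mul_assoc)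
      also have "\<dots> = l *\<^sub>R (Bmat t *v v)"
        by (simp add: Bmat_mult_transpose l matrix_vector_mult_scaleR)
      finally show ?thesis ..
    qed
    then show ?thesis
      using ev by (auto simp: orthonormal_eigenvectors_def norm_eq_1
          orthogonal_matrix_inner[OF orthogonal_matrix_Bmat])
  qed
  show ?thesis
    using Bmat_eq flow omega_limit_stationary[OF c] part2 part3 by blast
qed

end
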